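(* There exists a randomized algorithm that, given any $d$-regular bipartite graph $G=(P,Q,E)$ with $|P|=|Q|=n$ in adjacency array representation, finds a perfect matching of $G$ in $O(n\log n)$ expected time. Here the constant implied by $O(\cdot)$ is absolute (in particular independent of $d$).
   Context: A bipartite graph $G=(P,Q,E)$ has vertex set $P\cup Q$ and edge set $E\subseteq P\times Q$; it is $d$-regular if every vertex has degree $d$ (with $d \ge 1$). Regularity forces $|P|=|Q|$, and $n$ denotes this common value, so $G$ has $nd$ edges. Adjacency array representation: for each vertex, its $d$ neighbors are stored in an array, so that the $i$-th neighbor of a given vertex can be accessed in constant time; no assumption is made on the order of the neighbors within an array. Time is measured in the unit-cost random access machine model, where a uniformly random entry of an array can be drawn in constant time. The expectation is over the internal randomness of the algorithm, for a worst-case input. *)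

theory Defs
  imports "HOL-Probability.SPMF" "HOL-Library.Landau_Symbols"
begin

definition bipartite_graph :: "'v set \<Rightarrow> 'v set \<Rightarrow> ('v \<times> 'v) set \<Rightarrow> bool" where
  "bipartite_graph P Q E \<longleftrightarrow> finite P \<and> finite Q \<and> P \<inter> Q = {} \<and> E \<subseteq> P \<times> Q"

definition incident :: "('v \<times> 'v) set \<Rightarrow> 'v \<Rightarrow> ('v \<times> 'v) set" where
  "incident E v = {e \<in> E. fst e = v \<or> snd e = v}"

definition regular :: "'v set \<Rightarrow> 'v set \<Rightarrow> ('v \<times> 'v) set \<Rightarrow> nat \<Rightarrow> bool" where
  "regular P Q E d \<longleftrightarrow> (\<forall>v \<in> P \<union> Q. card (incident E v) = d)"

definition perfect_matching ::
    "'v set \<Rightarrow> 'v set \<Rightarrow> ('v \<times> 'v) set \<Rightarrow> ('v \<times> 'v) set \<Rightarrow> bool" where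
  "perfect_matching P Q E M \<longleftrightarrow> M \<subseteq> E \<and> (\<forall>v \<in> P \<union> Q. card (incident M v) = 1)"

record adj_input =
  num :: nat
  deg :: nat
  nbrs_P :: "nat list list"
  nbrs_Q :: "nat list list"

text \<open>
  The vertices of each side are numbered from 0 by the bijections \<open>p\<close> and \<open>q\<close>, and the array of a
  vertex lists the numbers of its neighbours on the other side, each once and in arbitrary order.
  The numberings are not part of the input.
\<close>

definition adjacency_arrays ::
    "'v set \<Rightarrow> 'v set \<Rightarrow> ('v \<times> 'v) set \<Rightarrow> nat \<Rightarrow> (nat \<Rightarrow> 'v) \<Rightarrow> (nat \<Rightarrow> 'v) \<Rightarrow> adj_input \<Rightarrow> bool" where
  "adjacency_arrays P Q E d p q I \<longleftrightarrow>
     num I = card P \<and> num I = card Q \<and> deg I = d \<and>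
     bij_betw p {..<num I} P \<and> bij_betw q {..<num I} Q \<and>
     length (nbrs_P I) = num I \<and> length (nbrs_Q I) = num I \<and>
     (\<forall>i<num I. length (nbrs_P I ! i) = d \<and> distinct (nbrs_P I ! i) \<and>
        set (nbrs_P I ! i) = {j. j < num I \<and> (p i, q j) \<in> E}) \<and>
     (\<forall>j<num I. length (nbrs_Q I ! j) = d \<and> distinct (nbrs_Q I ! j) \<and>
        set (nbrs_Q I ! j) = {i. i < num I \<and> (p i, q j) \<in> E})"

text \<open>
  A program is a fixed finite list of instructions, so it uses finitely many registers; the
  unbounded memory is reached only by indirect addressing, and the input arrays are read-only.
  Multiplication and division are deliberately absent: at unit cost they would make the machine
  unrealistically powerful. Numbers are naturals, and \<open>Sub\<close> truncates at 0.
  All arguments are register names (the destination first, for \<open>Store\<close> the register holding the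
  address first), except for the number in \<open>Const\<close> and the jump targets.
\<close>

datatype instr =
    Const nat nat
  | Move nat nat
  | Add nat nat nat
  | Sub nat nat nat
  | Load nat nat
  | Store nat nat
  | Nbr_P nat nat nat
  | Nbr_Q nat nat nat
  | Rand nat nat
  | Jump nat
  | Jump_Less nat nat nat

type_synonym program = "instr list"

record config =
  pc :: nat
  reg :: "nat \<Rightarrow> nat"
  mem :: "nat \<Rightarrow> nat"

definition lookup :: "nat list list \<Rightarrow> nat \<Rightarrow> nat \<Rightarrow> nat" where
  "lookup a u i = (if u < length a \<and> i < length (a ! u) then a ! u ! i else 0)"

definition set_reg :: "nat \<Rightarrow> nat \<Rightarrow> config \<Rightarrow> config" where
  "set_reg r x c = c\<lparr>reg := (reg c)(r := x), pc := Suc (pc c)\<rparr>"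

text \<open>
  \<open>Rand r m\<close> draws uniformly from the numbers below the content of \<open>m\<close> (yielding 0 if that content
  is 0), which is the drawing of a uniformly random array index.
\<close>

fun exec_instr :: "adj_input \<Rightarrow> instr \<Rightarrow> config \<Rightarrow> config pmf" where
  "exec_instr I (Const r k) c = return_pmf (set_reg r k c)"
| "exec_instr I (Move r s) c = return_pmf (set_reg r (reg c s) c)"
| "exec_instr I (Add r s t) c = return_pmf (set_reg r (reg c s + reg c t) c)"
| "exec_instr I (Sub r s t) c = return_pmf (set_reg r (reg c s - reg c t) c)"
| "exec_instr I (Load r a) c = return_pmf (set_reg r (mem c (reg c a)) c)"
| "exec_instr I (Store a s) c =
     return_pmf (c\<lparr>mem := (mem c)(reg c a := reg c s), pc := Suc (pc c)\<rparr>)"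
| "exec_instr I (Nbr_P r u i) c = return_pmf (set_reg r (lookup (nbrs_P I) (reg c u) (reg c i)) c)"
| "exec_instr I (Nbr_Q r v i) c = return_pmf (set_reg r (lookup (nbrs_Q I) (reg c v) (reg c i)) c)"
| "exec_instr I (Rand r m) c = map_pmf (\<lambda>x. set_reg r x c) (pmf_of_set {..<max 1 (reg c m)})"
| "exec_instr I (Jump l) c = return_pmf (c\<lparr>pc := l\<rparr>)"
| "exec_instr I (Jump_Less r s l) c =
     return_pmf (c\<lparr>pc := if reg c r < reg c s then l else Suc (pc c)\<rparr>)"

definition halted :: "program \<Rightarrow> config \<Rightarrow> bool" where
  "halted prog c \<longleftrightarrow> length prog \<le> pc c"

definition init_config :: "adj_input \<Rightarrow> config" where
  "init_config I = \<lparr>pc = 0, reg = (\<lambda>_. 0)(0 := num I, 1 := deg I), mem = (\<lambda>_. 0)\<rparr>"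

text \<open>
  The second component counts the executed instructions. A run that never halts contributes to the
  missing mass of the subprobability distribution.
\<close>

partial_function (spmf) run_from ::
    "program \<Rightarrow> adj_input \<Rightarrow> config \<times> nat \<Rightarrow> (config \<times> nat) spmf" where
  "run_from prog I ct =
     (if halted prog (fst ct) then return_spmf ct
      else bind_spmf (spmf_of_pmf (exec_instr I (prog ! pc (fst ct)) (fst ct)))
             (\<lambda>c'. run_from prog I (c', Suc (snd ct))))"

definition run :: "program \<Rightarrow> adj_input \<Rightarrow> (config \<times> nat) spmf" where
  "run prog I = run_from prog I (init_config I, 0)"

text \<open>The outcome \<open>None\<close> stands for divergence and counts as infinite running time.\<close>

definition expected_time :: "program \<Rightarrow> adj_input \<Rightarrow> ennreal" where
  "expected_time prog I =
     (\<integral>\<^sup>+ x. (case x of None \<Rightarrow> \<infinity> | Some (c, t) \<Rightarrow> of_nat t) \<partial>measure_pmf (run prog I))"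

text \<open>
  The output convention: for \<open>i < n\<close>, memory cell \<open>i\<close> holds the number of the vertex of \<open>Q\<close> matched to
  the vertex of \<open>P\<close> with number \<open>i\<close>.
\<close>

definition outputs_perfect_matching ::
    "'v set \<Rightarrow> 'v set \<Rightarrow> ('v \<times> 'v) set \<Rightarrow> (nat \<Rightarrow> 'v) \<Rightarrow> (nat \<Rightarrow> 'v) \<Rightarrow> nat \<Rightarrow> config \<Rightarrow> bool" where
  "outputs_perfect_matching P Q E p q n c \<longleftrightarrow>
     (\<forall>i<n. mem c i < n) \<and> perfect_matching P Q E ((\<lambda>i. (p i, q (mem c i))) ` {..<n})"

end

theory Submission
  imports Defs "HOL-Real_Asymp.Real_Asymp"
begin

text \<open>
  Grow a matching by one edge at a time. From a uniformly random unmatched vertex of \<open>P\<close> (found by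
  rejection), walk: go to a uniformly random neighbour in \<open>Q\<close>; stop if it is unmatched, otherwise
  continue from its mate. Let \<open>h u\<close> be the expected number of steps from \<open>u\<close>. Every vertex of \<open>Q\<close>
  has exactly \<open>d\<close> neighbours, so summing the recursion for \<open>h\<close> over all of \<open>P\<close> gives \<open>n\<close> plus the sum of
  \<open>h\<close> over the matched vertices. Hence \<open>h\<close> sums to \<open>n\<close> over the unmatched vertices, and its average
  over the starting vertex is \<open>n / (n - k)\<close> for a matching of size \<open>k\<close>; the total is \<open>n\<close> times a harmonic
  number. Each visited vertex remembers only its last choice: following these choices from the start
  yields a simple augmenting path, no longer than the walk. The existence of a perfect matching is
  not presupposed, since the bound on \<open>h\<close> shows that the walk succeeds.
\<close>

section \<open>Expected running time of a program\<close>

context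
  fixes prog :: program and I :: adj_input and good :: "config \<Rightarrow> bool"
begin

text \<open>
  The expected time truncated at \<open>m\<close> steps, with an infinite penalty for bad outcomes: a finite bound
  that holds for all \<open>m\<close> yields both the expected time and partial correctness.
\<close>

primrec cost :: "nat \<Rightarrow> config \<Rightarrow> ennreal" where
  "cost 0 c = 0"
| "cost (Suc m) c =
     (if halted prog c then (if good c then 0 else \<infinity>)
      else 1 + (\<integral>\<^sup>+ c'. cost m c' \<partial>measure_pmf (exec_instr I (prog ! pc c) c)))"

lemma cost_le_Suc: "cost m c \<le> cost (Suc m) c"
proof (induction m arbitrary: c)
  case (Suc m)
  have "(\<integral>\<^sup>+ c'. cost m c' \<partial>measure_pmf (exec_instr I (prog ! pc c) c)) \<le>
        (\<integral>\<^sup>+ c'. cost (Suc m) c' \<partial>measure_pmf (exec_instr I (prog ! pc c) c))"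
    by (intro nn_integral_mono Suc.IH)
  then show ?case
    by (subst (1 2) cost.simps(2)) (auto simp del: cost.simps intro!: add_left_mono)
qed simp

text \<open>Bounds obtained at a larger truncation carry over to smaller ones, so block lengths need
  not match an induction step exactly.\<close>

lemma cost_mono: "m \<le> m' \<Longrightarrow> cost m c \<le> cost m' c"
  by (rule lift_Suc_mono_le[where f = "\<lambda>m. cost m c"]) (use cost_le_Suc in auto)

text \<open>Divergence and bad outcomes are charged the level \<open>m\<close>, so their penalty is
  finite for each truncation and unbounded as \<open>m\<close> grows. The clock starts at
  \<open>t\<close>.\<close>

fun truncated_time :: "nat \<Rightarrow> nat \<Rightarrow> (config \<times> nat) option \<Rightarrow> ennreal" where
  "truncated_time m t None = of_nat m"
| "truncated_time m t (Some (c, t')) = (if good c then of_nat (min (t' - t) m) else of_nat m)"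

lemma truncated_time_Suc:
  "truncated_time (Suc m) t x \<le> 1 + truncated_time m (Suc t) x"
proof (cases x)
  case (Some y)
  obtain c t' where y: "y = (c, t')" by fastforce
  have "min (t' - t) (Suc m) \<le> Suc (min (t' - Suc t) m)" by linarith
  then have "(of_nat (min (t' - t) (Suc m)) :: ennreal) \<le> of_nat (Suc (min (t' - Suc t) m))"
    by (rule of_nat_mono)
  then show ?thesis using Some y by simp
qed simp

text \<open>Unfolding the run by one instruction moves the clock from \<open>t\<close> to
  \<open>Suc t\<close> and uses up one unit of the truncation.\<close>

lemma truncated_time_le_cost:
  "(\<integral>\<^sup>+ x. truncated_time m t x \<partial>measure_pmf (run_from prog I (c, t))) \<le> cost m c"
proof (induction m arbitrary: c t)
  case 0
  have "truncated_time 0 t x = 0" for x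
    by (cases "(0::nat, t, x)" rule: truncated_time.cases) auto
  then show ?case by simp
next
  case (Suc m)
  show ?case
  proof (cases "halted prog c")
    case True
    then show ?thesis
      by (subst run_from.simps) simp
  next
    case False
    let ?p = "exec_instr I (prog ! pc c) c"
    have "(\<integral>\<^sup>+ x. truncated_time (Suc m) t x \<partial>measure_pmf (run_from prog I (c, t))) =
      (\<integral>\<^sup>+ c'. \<integral>\<^sup>+ x. truncated_time (Suc m) t x \<partial>run_from prog I (c', Suc t) \<partial>?p)"
      using False by (subst run_from.simps) (simp add: bind_spmf_of_pmf)
    also have "\<dots> \<le> (\<integral>\<^sup>+ c'. \<integral>\<^sup>+ x. 1 + truncated_time m (Suc t) x \<partial>run_from prog I (c', Suc t) \<partial>?p)"
      by (intro nn_integral_mono truncated_time_Suc)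
    also have "\<dots> = 1 + (\<integral>\<^sup>+ c'. \<integral>\<^sup>+ x. truncated_time m (Suc t) x \<partial>run_from prog I (c', Suc t) \<partial>?p)"
      by (simp add: nn_integral_add)
    also have "\<dots> \<le> 1 + (\<integral>\<^sup>+ c'. cost m c' \<partial>?p)"
      by (intro add_left_mono nn_integral_mono Suc.IH)
    finally show ?thesis using False by simp
  qed
qed

text \<open>Monotone convergence in \<open>m\<close>: the limit \<open>F\<close> dominates the
  running time and is infinite on divergence and on bad outcomes. As its expectation is finite, no
  bad outcome has positive probability.\<close>

lemma run_time_le:
  assumes "\<And>m. cost m (init_config I) \<le> ennreal r"
  shows "expected_time prog I \<le> ennreal r"
    and "(c, t) \<in> set_spmf (run prog I) \<Longrightarrow> good c"
proof -
  define F :: "(config \<times> nat) option \<Rightarrow> ennreal" where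
    "F x = (SUP m. truncated_time m 0 x)" for x
  have F_top: "F x = \<infinity>" if "\<And>m. truncated_time m 0 x = of_nat m" for x
    using that by (simp add: F_def ennreal_SUP_of_nat_eq_top)
  have F_ge: "of_nat t' \<le> F (Some (c', t'))" for c' t'
  proof -
    have "of_nat t' \<le> truncated_time t' 0 (Some (c', t'))" by simp
    then show ?thesis unfolding F_def by (rule order_trans) (rule SUP_upper, simp)
  qed
  have mono: "truncated_time m 0 x \<le> truncated_time (Suc m) 0 x" for m x
    by (cases "(m, 0::nat, x)" rule: truncated_time.cases) (auto intro!: of_nat_mono simp: le_Suc_eq)
  have "(\<integral>\<^sup>+ x. F x \<partial>run prog I) = (SUP m. \<integral>\<^sup>+ x. truncated_time m 0 x \<partial>run prog I)"
    unfolding F_def by (rule nn_integral_monotone_convergence_SUP)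
      (auto intro!: incseq_SucI le_funI mono)
  also have "\<dots> \<le> ennreal r"
    unfolding run_def
    by (intro SUP_least order_trans[OF truncated_time_le_cost] assms)
  finally have F: "(\<integral>\<^sup>+ x. F x \<partial>run prog I) \<le> ennreal r" .
  have "expected_time prog I \<le> (\<integral>\<^sup>+ x. F x \<partial>run prog I)"
    unfolding expected_time_def
    by (intro nn_integral_mono) (auto split: option.splits simp: F_ge F_top)
  also note F
  finally show "expected_time prog I \<le> ennreal r" .
  show "good c" if "(c, t) \<in> set_spmf (run prog I)"
  proof (rule ccontr)
    assume "\<not> good c"
    then have "F (Some (c, t)) = \<infinity>" by (intro F_top) simp
    moreover have "(\<integral>\<^sup>+ x. F x \<partial>run prog I) \<noteq> \<infinity>" using F by (auto simp: top_unique)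
    then have "AE x in measure_pmf (run prog I). F x \<noteq> \<infinity>"
      by (intro nn_integral_PInf_AE) auto
    ultimately show False using that by (auto simp: AE_measure_pmf_iff in_set_spmf)
  qed
qed

text \<open>The bounds \<open>f i\<close> are nonnegative reals so that their mean can be taken
  outside extended arithmetic. The added 1 is the draw itself.\<close>

lemma cost_rand:
  assumes "\<not> halted prog c" "exec_instr I (prog ! pc c) c = map_pmf g (pmf_of_set {..<max 1 k})"
    and "k \<ge> 1" "\<And>i. i < k \<Longrightarrow> cost m (g i) \<le> ennreal (f i)" "\<And>i. i < k \<Longrightarrow> 0 \<le> f i"
    and "1 + (\<Sum>i<k. f i) / real k \<le> r"
  shows "cost (Suc m) c \<le> ennreal r"
proof -
  have "cost (Suc m) c = 1 + (\<Sum>i<k. cost m (g i)) / of_nat k"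
    using assms(1-3) by (simp add: max_absorb2 nn_integral_pmf_of_set lessThan_empty_iff)
  also have "\<dots> \<le> 1 + (\<Sum>i<k. ennreal (f i)) / of_nat k"
    using assms(4) by (intro add_left_mono divide_right_mono_ennreal sum_mono) auto
  also have "(\<Sum>i<k. ennreal (f i)) = ennreal (\<Sum>i<k. f i)"
    using assms(5) by (intro sum_ennreal) auto
  also have "1 + \<dots> / of_nat k = ennreal (1 + (\<Sum>i<k. f i) / real k)"
  proof -
    have "0 \<le> (\<Sum>i<k. f i)" using assms(5) by (intro sum_nonneg) auto
    then show ?thesis
      using assms(3) by (simp add: ennreal_plus ennreal_of_nat_eq_real_of_nat divide_ennreal)
  qed
  also have "\<dots> \<le> ennreal r" using assms(6) by (rule ennreal_leI)
  finally show ?thesis .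
qed

lemma cost_det:
  assumes "\<not> halted prog c" "exec_instr I (prog ! pc c) c = return_pmf c'"
    and "cost m c' \<le> ennreal s" "0 \<le> s" "1 + s \<le> r"
  shows "cost (Suc m) c \<le> ennreal r"
proof -
  have "cost (Suc m) c = 1 + cost m c'" using assms(1,2) by simp
  also have "\<dots> \<le> ennreal (1 + s)"
    using assms(3,4) by (simp add: ennreal_plus)
  also have "\<dots> \<le> ennreal r" using assms(5) by (rule ennreal_leI)
  finally show ?thesis .
qed

end

section \<open>Hitting times of the random walk\<close>

text \<open>Only the arrays of \<open>P\<close> appear; regularity on the side of \<open>Q\<close>
  becomes a count of the arrays that contain \<open>v\<close>.\<close>

locale regular_arrays =
  fixes n d :: nat and nb :: "nat \<Rightarrow> nat list"
  assumes d_pos: "d \<ge> 1"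
    and length_nb: "u < n \<Longrightarrow> length (nb u) = d"
    and distinct_nb: "u < n \<Longrightarrow> distinct (nb u)"
    and nb_less: "u < n \<Longrightarrow> v \<in> set (nb u) \<Longrightarrow> v < n"
    and card_nbrs: "v < n \<Longrightarrow> card {u. u < n \<and> v \<in> set (nb u)} = d"
begin

text \<open>A matching is stored from the side of \<open>Q\<close>: \<open>mate v\<close> is the
  partner in \<open>P\<close>, so \<open>ran mate\<close> is the set of matched vertices of
  \<open>P\<close>.\<close>

definition valid :: "(nat \<Rightarrow> nat option) \<Rightarrow> bool" where
  "valid mate \<longleftrightarrow>
     (\<forall>v u. mate v = Some u \<longrightarrow> v < n \<and> u < n \<and> v \<in> set (nb u)) \<and> inj_on mate (dom mate)"

lemma validD:
  assumes "valid mate" "mate v = Some u"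
  shows "v < n" "u < n" "v \<in> set (nb u)"
  using assms unfolding valid_def by blast+

lemma valid_inj:
  assumes "valid mate" "mate v = Some u" "mate v' = Some u"
  shows "v = v'"
  using assms inj_onD[of mate "dom mate" v v'] unfolding valid_def by auto

lemma ran_valid: "valid mate \<Longrightarrow> ran mate \<subseteq> {..<n}"
  by (auto simp: ran_def dest: validD)

text \<open>Expected number of steps of the walk from \<open>u\<close>, cut off after
  \<open>m\<close> steps; drawing an unmatched vertex of \<open>Q\<close> ends the walk.\<close>

primrec hit :: "(nat \<Rightarrow> nat option) \<Rightarrow> nat \<Rightarrow> nat \<Rightarrow> real" where
  "hit mate 0 u = 0"
| "hit mate (Suc m) u =
     1 + (\<Sum>i<d. case mate (nb u ! i) of None \<Rightarrow> 0 | Some w \<Rightarrow> hit mate m w) / real d"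

lemma hit_nonneg: "0 \<le> hit mate m u"
  by (induction m arbitrary: u) (auto intro!: add_nonneg_nonneg divide_nonneg_nonneg sum_nonneg split: option.split)

lemma hit_le_Suc: "hit mate m u \<le> hit mate (Suc m) u"
proof (induction m arbitrary: u)
  case 0
  then show ?case by (simp only: hit.simps(1) hit_nonneg)
next
  case (Suc m)
  show ?case
    by (subst (1 2) hit.simps(2))
      (intro add_left_mono divide_right_mono sum_mono, auto split: option.split simp del: hit.simps simp: Suc.IH)
qed

text \<open>Double counting: \<open>f v\<close> is collected once from each of the \<open>d\<close>
  arrays that contain \<open>v\<close>.\<close>

lemma sum_nbrs:
  fixes f :: "nat \<Rightarrow> real"
  shows "(\<Sum>u<n. \<Sum>i<d. f (nb u ! i)) = real d * (\<Sum>v<n. f v)"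
proof -
  have "(\<Sum>i<d. f (nb u ! i)) = (\<Sum>v<n. if v \<in> set (nb u) then f v else 0)" if "u < n" for u
  proof -
    have "(\<Sum>i<d. f (nb u ! i)) = sum f (set (nb u))"
      using sum.reindex_bij_betw[OF bij_betw_nth[OF distinct_nb[OF that] refl refl], of f]
      by (simp add: length_nb[OF that])
    also have "\<dots> = (\<Sum>v<n. if v \<in> set (nb u) then f v else 0)"
      using nb_less[OF that] by (intro sum.mono_neutral_cong_left) auto
    finally show ?thesis .
  qed
  then have "(\<Sum>u<n. \<Sum>i<d. f (nb u ! i)) = (\<Sum>u<n. \<Sum>v<n. if v \<in> set (nb u) then f v else 0)"
    by simp
  also have "\<dots> = (\<Sum>v<n. \<Sum>u<n. if v \<in> set (nb u) then f v else 0)"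
    by (rule sum.swap)
  also have "\<dots> = (\<Sum>v<n. real d * f v)"
  proof (rule sum.cong[OF refl])
    fix v assume "v \<in> {..<n}"
    then have "card {u. u < n \<and> v \<in> set (nb u)} = d" by (simp add: card_nbrs)
    moreover have "{..<n} \<inter> {u. v \<in> set (nb u)} = {u. u < n \<and> v \<in> set (nb u)}" by auto
    ultimately show "(\<Sum>u<n. if v \<in> set (nb u) then f v else 0) = real d * f v"
      by (simp add: sum.If_cases)
  qed
  finally show ?thesis by (simp add: sum_distrib_left)
qed

text \<open>Reindexing along the bijection \<open>mate\<close> between the matched vertices of the
  two sides.\<close>

lemma sum_mates:
  fixes f :: "nat \<Rightarrow> real"
  assumes "valid mate"
  shows "(\<Sum>v<n. case mate v of None \<Rightarrow> 0 | Some w \<Rightarrow> f w) = sum f (ran mate)"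
proof -
  have "bij_betw (the \<circ> mate) (dom mate) (ran mate)"
    using assms by (force simp: bij_betw_def inj_on_def ran_def valid_inj image_iff dom_def)
  then have "(\<Sum>v\<in>dom mate. f ((the \<circ> mate) v)) = sum f (ran mate)"
    by (rule sum.reindex_bij_betw)
  moreover have "(\<Sum>v<n. case mate v of None \<Rightarrow> 0 | Some w \<Rightarrow> f w) =
      (\<Sum>v\<in>dom mate. f ((the \<circ> mate) v))"
    using validD(1)[OF assms] by (intro sum.mono_neutral_cong_right) (auto split: option.splits)
  ultimately show ?thesis by simp
qed

text \<open>
  For walks truncated at \<open>m\<close> steps, monotonicity in \<open>m\<close> replaces the cancellation of the matched part.
\<close>

lemma sum_hit_unmatched_le:
  assumes "valid mate"
  shows "(\<Sum>u\<in>{..<n} - ran mate. hit mate m u) \<le> real n"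
proof (cases m)
  case (Suc m')
  have "(\<Sum>u<n. hit mate m u) =
      real n + (\<Sum>u<n. \<Sum>i<d. case mate (nb u ! i) of None \<Rightarrow> 0 | Some w \<Rightarrow> hit mate m' w) / real d"
    unfolding Suc hit.simps by (simp add: sum.distrib sum_divide_distrib)
  also have "\<dots> = real n + sum (hit mate m') (ran mate)"
    using d_pos sum_nbrs[of "\<lambda>v. case mate v of None \<Rightarrow> 0 | Some w \<Rightarrow> hit mate m' w"]
    by (simp add: sum_mates[OF assms])
  also have "\<dots> \<le> real n + sum (hit mate m) (ran mate)"
    unfolding Suc by (intro add_left_mono sum_mono hit_le_Suc)
  finally show ?thesis
    by (simp add: sum_diff[OF finite_lessThan ran_valid[OF assms]])
qed simp

end

section \<open>The program\<close>

text \<open>From 3 on a start vertex is drawn by rejection, from 8 on the walk runs, from 15 on the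
  path is augmented; 23 and 24 form the outer loop. Registers 0 to 4 hold \<open>n\<close>,
  \<open>d\<close>, the size of the matching, \<open>2 * n\<close> and 1. Register 5 holds the
  address of the start vertex, later of the vertex being rematched, and 6 that of the current vertex
  of the walk. Register 9 is never written, so comparing with it tests for nonzero.\<close>

definition match_prog :: program where
  "match_prog =
    [Const 4 1,
     Add 3 0 0,
     Jump 24,
     Rand 5 0,
     Add 5 5 3,
     Load 6 5,
     Jump_Less 9 6 3,
     Move 6 5,
     Sub 7 6 3,
     Rand 8 1,
     Nbr_P 7 7 8,
     Add 7 7 0,
     Store 6 7,
     Load 6 7,
     Jump_Less 9 6 8,
     Load 7 5,
     Load 6 7,
     Store 7 5,
     Sub 8 5 3,
     Sub 7 7 0,
     Store 8 7,
     Move 5 6,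
     Jump_Less 9 5 15,
     Add 2 2 4,
     Jump_Less 2 0 3]"

lemma length_match_prog: "length match_prog = 25"
  by (simp add: match_prog_def)

lemma fetch:
  "match_prog ! 0 = Const 4 1"
  "match_prog ! 1 = Add 3 0 0"
  "match_prog ! 2 = Jump 24"
  "match_prog ! 3 = Rand 5 0"
  "match_prog ! 4 = Add 5 5 3"
  "match_prog ! 5 = Load 6 5"
  "match_prog ! 6 = Jump_Less 9 6 3"
  "match_prog ! 7 = Move 6 5"
  "match_prog ! 8 = Sub 7 6 3"
  "match_prog ! 9 = Rand 8 1"
  "match_prog ! 10 = Nbr_P 7 7 8"
  "match_prog ! 11 = Add 7 7 0"
  "match_prog ! 12 = Store 6 7"
  "match_prog ! 13 = Load 6 7"
  "match_prog ! 14 = Jump_Less 9 6 8"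
  "match_prog ! 15 = Load 7 5"
  "match_prog ! 16 = Load 6 7"
  "match_prog ! 17 = Store 7 5"
  "match_prog ! 18 = Sub 8 5 3"
  "match_prog ! 19 = Sub 7 7 0"
  "match_prog ! 20 = Store 8 7"
  "match_prog ! 21 = Move 5 6"
  "match_prog ! 22 = Jump_Less 9 5 15"
  "match_prog ! 23 = Add 2 2 4"
  "match_prog ! 24 = Jump_Less 2 0 3"
  by (simp_all add: match_prog_def)

lemma add_numeral_Suc:
  "m + 3 = Suc (Suc (Suc m))"
  "m + 4 = Suc (Suc (Suc (Suc m)))"
  "m + 5 = Suc (Suc (Suc (Suc (Suc m))))"
  "m + 7 = Suc (Suc (Suc (Suc (Suc (Suc (Suc m))))))"
  "m + 8 = Suc (Suc (Suc (Suc (Suc (Suc (Suc (Suc m)))))))"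
  by simp_all

lemmas exec_simps = halted_def length_match_prog fetch set_reg_def

locale matching_machine = regular_arrays n d "(!) (nbrs_P I)" for n d and I :: adj_input +
  assumes num_I: "num I = n" and deg_I: "deg I = d" and length_I: "length (nbrs_P I) = n"
begin

abbreviation nb :: "nat \<Rightarrow> nat list" where "nb \<equiv> (!) (nbrs_P I)"

definition correct :: "config \<Rightarrow> bool" where
  "correct c \<longleftrightarrow> (\<exists>mate. valid mate \<and> ran mate = {..<n} \<and> (\<forall>v u. mate v = Some u \<longrightarrow> mem c u = v))"

abbreviation tcost :: "nat \<Rightarrow> config \<Rightarrow> ennreal" where
  "tcost \<equiv> cost match_prog I correct"

abbreviation conf :: "nat \<Rightarrow> (nat \<Rightarrow> nat) \<Rightarrow> (nat \<Rightarrow> nat) \<Rightarrow> config" where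
  "conf l R M \<equiv> \<lparr>pc = l, reg = R, mem = M\<rparr>"

definition regs :: "nat \<Rightarrow> (nat \<Rightarrow> nat) \<Rightarrow> bool" where
  "regs k R \<longleftrightarrow> R 0 = n \<and> R 1 = d \<and> R 2 = k \<and> R 3 = 2 * n \<and> R 4 = 1 \<and> R 9 = 0"

section \<open>Cost of single instructions and of one round of each inner loop\<close>

lemma tcost_det:
  assumes "\<not> halted match_prog c" "exec_instr I (match_prog ! pc c) c = return_pmf c'"
    and "tcost m c' \<le> ennreal s" "0 \<le> s" "1 + s \<le> r"
  shows "tcost m c \<le> ennreal r"
  using cost_det[where good = correct, OF assms] cost_le_Suc order_trans by blast

text \<open>One rematching takes the 8 instructions 15 to 22. The old content of the chosen cell,
  the address of the displaced vertex or 0, becomes the next value of register 5.\<close>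

lemma augment_block:
  assumes "regs k R"
  obtains R' where "regs k R'" "R' 5 = M (M (R 5))"
    "tcost (m + 8) (conf 15 R M) =
     8 + tcost m (conf (if 0 < R' 5 then 15 else 23) R'
           (M(M (R 5) := R 5, R 5 - 2 * n := M (R 5) - n)))"
proof -
  let ?R = "R(7 := M (R 5) - n, 6 := M (M (R 5)), 8 := R 5 - 2 * n, 5 := M (M (R 5)))"
  have "tcost (m + 8) (conf 15 R M) =
     8 + tcost m (conf (if 0 < ?R 5 then 15 else 23) ?R
           (M(M (R 5) := R 5, R 5 - 2 * n := M (R 5) - n)))"
    using assms
    by (simp add: add_numeral_Suc exec_simps regs_def fun_upd_twist flip: add.assoc cong: if_cong split del: if_split)
  moreover have "regs k ?R" "?R 5 = M (M (R 5))" using assms by (simp_all add: regs_def)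
  ultimately show ?thesis using that by blast
qed

text \<open>The 7 instructions of a walk step are one before the draw, the draw, and five after it,
  the last of which tests whether the chosen vertex has a mate.\<close>

lemma walk_block:
  assumes R: "regs k R" "R 6 = 2 * n + u" and u: "u < n"
    and next_le: "\<And>i R'. i < d \<Longrightarrow> regs k R' \<Longrightarrow> R' 5 = R 5 \<Longrightarrow> R' 6 = M (nb u ! i + n) \<Longrightarrow>
      tcost m (conf (if 0 < R' 6 then 8 else 15) R' (M(2 * n + u := nb u ! i + n))) \<le> ennreal (f i)"
    and f: "\<And>i. i < d \<Longrightarrow> 0 \<le> f i" and r: "7 + (\<Sum>i<d. f i) / real d \<le> r"
  shows "tcost (m + 7) (conf 8 R M) \<le> ennreal r"
proof -
  let ?R = "\<lambda>i. R(7 := u, 8 := i)"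
  have step: "tcost (m + 5) (conf 10 (?R i) M) \<le> ennreal (5 + f i)" if i: "i < d" for i
  proof -
    let ?v = "nb u ! i"
    let ?R' = "R(7 := ?v + n, 8 := i, 6 := M (?v + n))"
    have v: "?v < n" using nb_less[OF u] length_nb[OF u] i by simp
    have "tcost (m + 5) (conf 10 (?R i) M) =
        5 + tcost m (conf (if 0 < ?R' 6 then 8 else 15) ?R' (M(2 * n + u := ?v + n)))"
      using R u v i
      by (simp add: add_numeral_Suc exec_simps regs_def fun_upd_twist lookup_def length_I length_nb
            flip: add.assoc cong: if_cong split del: if_split)
    also have "\<dots> \<le> 5 + ennreal (f i)"
      using R by (intro add_left_mono next_le i) (simp_all add: regs_def)
    also have "\<dots> = ennreal (5 + f i)" using f[OF i] by (simp add: ennreal_plus)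
    finally show ?thesis .
  qed
  have sum: "0 \<le> (\<Sum>i<d. f i)" using f by (intro sum_nonneg) auto
  have "tcost (Suc (m + 5)) (conf 9 (R(7 := u)) M) \<le> ennreal (6 + (\<Sum>i<d. f i) / real d)"
  proof (rule cost_rand)
    show "exec_instr I (match_prog ! pc (conf 9 (R(7 := u)) M)) (conf 9 (R(7 := u)) M) =
        map_pmf (\<lambda>i. conf 10 (?R i) M) (pmf_of_set {..<max 1 d})"
      using R by (simp add: exec_simps regs_def)
    show "1 + (\<Sum>i<d. 5 + f i) / real d \<le> 6 + (\<Sum>i<d. f i) / real d"
      using d_pos by (simp add: sum.distrib add_divide_distrib)
  qed (use d_pos step f in \<open>auto simp: exec_simps\<close>)
  then have "tcost (Suc (Suc (m + 5))) (conf 8 R M) \<le> ennreal r"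
    by (rule cost_det[rotated 2]) (use R r sum in \<open>auto simp: exec_simps regs_def\<close>)
  then show ?thesis by (simp add: add_numeral_Suc)
qed

lemma start_block:
  assumes R: "regs k R" and n: "n \<ge> 1"
    and next_le: "\<And>i R'. i < n \<Longrightarrow> regs k R' \<Longrightarrow> R' 5 = 2 * n + i \<Longrightarrow>
      tcost m (conf (if 0 < M (i + 2 * n) then 3 else 7) R' M) \<le> ennreal (f i)"
    and f: "\<And>i. i < n \<Longrightarrow> 0 \<le> f i" and r: "4 + (\<Sum>i<n. f i) / real n \<le> r"
  shows "tcost (m + 4) (conf 3 R M) \<le> ennreal r"
proof -
  have step: "tcost (m + 3) (conf 4 (R(5 := i)) M) \<le> ennreal (3 + f i)" if i: "i < n" for i
  proof -
    let ?R' = "R(5 := i + 2 * n, 6 := M (i + 2 * n))"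
    have "tcost (m + 3) (conf 4 (R(5 := i)) M) =
        3 + tcost m (conf (if 0 < M (i + 2 * n) then 3 else 7) ?R' M)"
      using R
      by (simp add: add_numeral_Suc exec_simps regs_def fun_upd_twist flip: add.assoc cong: if_cong split del: if_split)
    also have "\<dots> \<le> 3 + ennreal (f i)"
      using R by (intro add_left_mono next_le i) (simp_all add: regs_def)
    also have "\<dots> = ennreal (3 + f i)" using f[OF i] by (simp add: ennreal_plus)
    finally show ?thesis .
  qed
  have "tcost (Suc (m + 3)) (conf 3 R M) \<le> ennreal r"
  proof (rule cost_rand)
    show "exec_instr I (match_prog ! pc (conf 3 R M)) (conf 3 R M) =
        map_pmf (\<lambda>i. conf 4 (R(5 := i)) M) (pmf_of_set {..<max 1 n})"
      using R by (simp add: exec_simps regs_def)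
    show "1 + (\<Sum>i<n. 3 + f i) / real n \<le> r"
      using n r by (simp add: sum.distrib add_divide_distrib)
  qed (use n step f in \<open>auto simp: exec_simps\<close>)
  then show ?thesis by (simp add: add_numeral_Suc)
qed

section \<open>Correctness and expected time of the program\<close>

text \<open>
  Memory layout: cell \<open>i < n\<close> holds the neighbour matched to \<open>i\<close>, cell \<open>n + v\<close> the mate of \<open>v\<close>, and
  cell \<open>2 * n + u\<close> the neighbour chosen at the last visit of \<open>u\<close>. Chosen neighbours and mates are
  stored as the addresses of their cells, so that 0 can stand for none.
\<close>

definition rep :: "(nat \<Rightarrow> nat option) \<Rightarrow> (nat \<Rightarrow> nat) \<Rightarrow> bool" where
  "rep mate M \<longleftrightarrow>
     (\<forall>v<n. M (v + n) = (case mate v of None \<Rightarrow> 0 | Some u \<Rightarrow> 2 * n + u)) \<and>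
     (\<forall>v u. mate v = Some u \<longrightarrow> M u = v)"

text \<open>A nonzero choice cell is the program's test for being matched. \<open>A\<close> is
  \<open>ran mate\<close> between augmentations and also contains the start vertex during
  one.\<close>

definition marked :: "nat set \<Rightarrow> (nat \<Rightarrow> nat) \<Rightarrow> bool" where
  "marked A M \<longleftrightarrow> (\<forall>u<n. 0 < M (2 * n + u) \<longleftrightarrow> u \<in> A)"

text \<open>One step of an alternating path: from \<open>x\<close> via its remembered choice to the
  mate of the chosen vertex. \<open>None\<close> means that this vertex is free and the path
  ends.\<close>

definition link :: "(nat \<Rightarrow> nat option) \<Rightarrow> (nat \<Rightarrow> nat) \<Rightarrow> nat \<Rightarrow> nat option \<Rightarrow> bool" where
  "link mate M x y \<longleftrightarrow> (\<exists>v \<in> set (nb x). M (2 * n + x) = v + n \<and> mate v = y)"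

abbreviation path :: "(nat \<Rightarrow> nat option) \<Rightarrow> (nat \<Rightarrow> nat) \<Rightarrow> nat list \<Rightarrow> bool" where
  "path mate M \<equiv> successively (\<lambda>x y. link mate M x (Some y))"

text \<open>For rematching, which breaks only the link entering the head of the remaining
  path.\<close>

lemma successively_mono_tl:
  assumes "successively P xs" "\<And>a b. b \<in> set (tl xs) \<Longrightarrow> P a b \<Longrightarrow> Q a b"
  shows "successively Q xs"
  using assms by (induction P xs rule: successively.induct) auto

text \<open>For a new choice of the walk, which overwrites only the link leaving the last
  vertex.\<close>

lemma successively_mono_butlast:
  assumes "successively P xs" "\<And>a b. a \<in> set (butlast xs) \<Longrightarrow> P a b \<Longrightarrow> Q a b"
  shows "successively Q xs"
  using assms by (induction P xs rule: successively.induct) (auto split: if_splits)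

section \<open>Rematching and augmenting paths\<close>

lemma valid_upd:
  assumes "valid mate" "x < n" "v \<in> set (nb x)" "x \<notin> ran mate"
  shows "valid (mate(v := Some x))"
  unfolding valid_def
proof (intro conjI allI impI)
  fix v' u assume "(mate(v := Some x)) v' = Some u"
  then show "v' < n" "u < n" "v' \<in> set (nb u)"
    using assms nb_less[of x v] validD[OF assms(1), of v' u] by (auto split: if_splits)
next
  show "inj_on (mate(v := Some x)) (dom (mate(v := Some x)))"
  proof (rule inj_onI)
    fix a b assume ab: "a \<in> dom (mate(v := Some x))" "b \<in> dom (mate(v := Some x))"
      "(mate(v := Some x)) a = (mate(v := Some x)) b"
    then obtain u where "(mate(v := Some x)) a = Some u" "(mate(v := Some x)) b = Some u"
      by (metis domD)
    then show "a = b"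
      using valid_inj[OF assms(1), of a u b] assms(4) ranI[of mate a x] ranI[of mate b x]
      by (auto split: if_splits)
  qed
qed

lemma ran_upd:
  assumes "valid mate" "x \<notin> ran mate"
  shows "ran (mate(v := Some x)) = insert x (ran mate - set_option (mate v))"
proof -
  have "mate v' = Some u \<Longrightarrow> v' \<noteq> v \<Longrightarrow> mate v \<noteq> Some u" for v' u
    using valid_inj[OF assms(1)] by blast
  moreover have "u \<in> ran (mate(v := Some x))" if "mate v' = Some u" "v' \<noteq> v" for u v'
    using that by (auto intro: ranI[of _ v'])
  ultimately show ?thesis
    by (auto simp: ran_def split: if_splits) (metis option.set_sel option.discI option.sel option.set_intros)
qed

text \<open>The displaced vertex keeps a stale output cell, which \<open>rep\<close> permits because
  it constrains only output cells of matched vertices.\<close>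

lemma rep_upd:
  assumes "valid mate" "rep mate M" "x < n" "v < n" "x \<notin> ran mate"
  shows "rep (mate(v := Some x)) (M(v + n := 2 * n + x, x := v))"
  using assms validD[OF assms(1)] ranI[of mate _ x] by (auto simp: rep_def)

text \<open>The set \<open>insert (hd xs) (ran mate)\<close> is invariant: rematching the head frees
  exactly its successor. At the last vertex nothing is freed, so all of \<open>A\<close> is matched.
  Each vertex costs one round of 8 instructions.\<close>

lemma augment:
  assumes "regs k R" "R 5 = 2 * n + hd xs"
    and "valid mate" "rep mate M" "marked A M"
    and "xs \<noteq> []" "distinct xs" "set xs \<subseteq> {..<n}" "path mate M xs" "link mate M (last xs) None"
    and "hd xs \<notin> ran mate" "insert (hd xs) (ran mate) = A"
    and s: "0 \<le> s" "\<And>mate' R' M'. regs k R' \<Longrightarrow> valid mate' \<Longrightarrow> rep mate' M' \<Longrightarrow> marked A M' \<Longrightarrow>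
       ran mate' = A \<Longrightarrow> tcost m (conf 23 R' M') \<le> ennreal s"
  shows "tcost m (conf 15 R M) \<le> ennreal (8 * real (length xs) + s)"
  using assms(1-12)
proof (induction xs arbitrary: R M mate)
  case (Cons x ys)
  have x: "x < n" "x \<notin> ran mate" "R 5 = 2 * n + x" using Cons.prems by auto
  obtain v where v: "v \<in> set (nb x)" "M (2 * n + x) = v + n"
      "mate v = (if ys = [] then None else Some (hd ys))"
    using Cons.prems(9,10) by (auto simp: link_def successively_Cons split: if_splits)
  have vn: "v < n" using nb_less[OF x(1) v(1)] .
  define M' where "M' = M(v + n := 2 * n + x, x := v)"
  define mate' where "mate' = mate(v := Some x)"
  have valid': "valid mate'" unfolding mate'_def using valid_upd[OF Cons.prems(3) x(1) v(1) x(2)] .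
  have rep': "rep mate' M'"
    unfolding mate'_def M'_def using rep_upd[OF Cons.prems(3,4) x(1) vn x(2)] .
  \<comment> \<open>Both cells written lie below \<open>2 * n\<close>, so the remembered choices
    survive.\<close>
  have choice: "M' (2 * n + u) = M (2 * n + u)" for u
    using x vn by (auto simp: M'_def)
  have marked': "marked A M'" using Cons.prems(5) by (simp add: marked_def choice)
  have ran': "ran mate' = insert x (ran mate - set_option (mate v))"
    unfolding mate'_def by (rule ran_upd[OF Cons.prems(3) x(2)])
  obtain R' where R': "regs k R'" "R' 5 = M (v + n)"
    and step: "tcost (m + 8) (conf 15 R M) = 8 + tcost m (conf (if 0 < R' 5 then 15 else 23) R' M')"
    using augment_block[OF Cons.prems(1), of M m] v(2) x(3) unfolding M'_def by auto
  have R'5: "R' 5 = (if ys = [] then 0 else 2 * n + hd ys)"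
    using R'(2) Cons.prems(4) vn v(3) by (simp add: rep_def)
  have "tcost m (conf (if 0 < R' 5 then 15 else 23) R' M') \<le> ennreal (8 * real (length ys) + s)"
  proof (cases "ys = []")
    case True
    then show ?thesis
      using s(2)[OF R'(1) valid' rep' marked'] R'5 ran' v(3) Cons.prems(12) by simp
  next
    case False
    \<comment> \<open>Only \<open>v\<close> gets a new mate, and its old mate is
      \<open>hd ys\<close>; links with any other target are intact. By distinctness this covers all
      links inside \<open>ys\<close>.\<close>
    have link': "link mate' M' z y" if "link mate M z y" "y \<noteq> Some (hd ys)" for z y
      using that v(3) False by (auto simp: link_def choice mate'_def)
    have hd_ran: "hd ys \<in> ran mate" using v(3) False by (auto simp: ran_def)
    have path: "path mate M ys" using Cons.prems(9) False by (simp add: successively_Cons)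
    have "b \<noteq> hd ys" if "b \<in> set (tl ys)" for b
      using that Cons.prems(7) False by (cases ys) auto
    then have path': "path mate' M' ys"
      by (intro successively_mono_tl[OF path] link') auto
    have last': "link mate' M' (last ys) None"
      using link' Cons.prems(10) False by simp
    have ran'': "hd ys \<notin> ran mate'" "insert (hd ys) (ran mate') = A"
      using ran' v(3) False Cons.prems(7,12) hd_ran by auto
    show ?thesis
      using Cons.IH[OF R'(1) _ valid' rep' marked' False _ _ path' last' ran''] R'5 Cons.prems(7,8) False
      by simp
  qed
  then have "tcost (m + 8) (conf 15 R M) \<le> 8 + ennreal (8 * real (length ys) + s)"
    unfolding step by (rule add_left_mono)
  also have "\<dots> = ennreal (8 * real (length (x # ys)) + s)"
    using s(1) by (simp add: ennreal_plus algebra_simps flip: ennreal_numeral)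
  finally show ?case
    using cost_mono[of m "m + 8" match_prog I correct "conf 15 R M"] by simp
qed simp

text \<open>Loop erasure: a new \<open>w\<close> is appended, a revisited one cuts the list back to
  its occurrence. Overwriting the choice of the last vertex harms no link in the list, since by
  distinctness that vertex occurs only at the end.\<close>

lemma path_step:
  assumes "path mate M xs" "xs \<noteq> []" "distinct xs" "v \<in> set (nb (last xs))" "mate v = Some w"
  obtains ys where "path mate (M(2 * n + last xs := v + n)) ys" "ys \<noteq> []" "distinct ys"
    "hd ys = hd xs" "last ys = w" "set ys \<subseteq> insert w (set xs)" "length ys \<le> Suc (length xs)"
proof -
  define M' where "M' = M(2 * n + last xs := v + n)"
  have "last xs \<notin> set (butlast xs)"
    using assms(2,3) by (metis append_butlast_last_id distinct_append disjoint_iff list.set_intros(1))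
  then have xs: "path mate M' xs"
    by (intro successively_mono_butlast[OF assms(1)]) (auto simp: link_def M'_def)
  have last: "link mate M' (last xs) (Some w)"
    using assms(4,5) by (auto simp: link_def M'_def)
  show ?thesis
  proof (cases "w \<in> set xs")
    case False
    have "path mate M' (xs @ [w])" using xs last by (auto simp: successively_append_iff)
    then show ?thesis using False assms(2,3) by (intro that[of "xs @ [w]"]) (auto simp: M'_def)
  next
    case True
    then obtain as bs where split: "xs = as @ w # bs" by (auto dest: split_list)
    have "path mate M' (as @ [w])"
      using xs unfolding split by (auto simp: successively_append_iff successively_Cons)
    then show ?thesis using assms(3) split
      by (intro that[of "as @ [w]"]) (auto simp: M'_def hd_append)
  qed
qed

text \<open>
  Of the 15 units paid per step of the walk, 7 are the instructions executed and 8 are saved for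
  augmenting along one vertex of the path.
\<close>

lemma walk:
  assumes "regs k R" "R 5 = 2 * n + hd xs" "R 6 = 2 * n + last xs"
    and "valid mate" "rep mate M" "\<And>u. u < n \<Longrightarrow> u \<noteq> x0 \<Longrightarrow> 0 < M (2 * n + u) \<longleftrightarrow> u \<in> ran mate"
    and "xs \<noteq> []" "hd xs = x0" "distinct xs" "set xs \<subseteq> insert x0 (ran mate)" "path mate M xs"
    and "x0 < n" "x0 \<notin> ran mate"
    and s: "0 \<le> s" "\<And>m mate' R' M'. regs k R' \<Longrightarrow> valid mate' \<Longrightarrow> rep mate' M' \<Longrightarrow>
       marked (insert x0 (ran mate)) M' \<Longrightarrow> ran mate' = insert x0 (ran mate) \<Longrightarrow>
       tcost m (conf 23 R' M') \<le> ennreal s"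
  shows "tcost m (conf 8 R M) \<le> ennreal (15 * hit mate m (last xs) + 8 * (real (length xs) - 1) + s)"
  using assms(1-13)
proof (induction m arbitrary: R M xs)
  case (Suc m)
  define u where "u = last xs"
  have xs_less: "set xs \<subseteq> {..<n}"
    using Suc.prems(10,12) ran_valid[OF Suc.prems(4)] by auto
  have "u \<in> set xs" using Suc.prems(7) by (simp add: u_def)
  with xs_less have u: "u \<in> set xs" "u < n" by auto
  \<comment> \<open>The term \<open>8 * length xs\<close> fits both outcomes: it pays for augmenting
    along all of \<open>xs\<close> if the walk stops, and is the saving for a path with one more
    vertex if it continues. The step under way supplies the missing 8.\<close>
  define f where "f i = 15 * (case mate (nb u ! i) of None \<Rightarrow> 0 | Some w \<Rightarrow> hit mate m w) +
    (8 * real (length xs) + s)" for i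
  have f_nonneg: "0 \<le> f i" for i
    using s(1) by (auto simp: f_def hit_nonneg split: option.split)
  have sum_f: "7 + (\<Sum>i<d. f i) / real d = 15 * hit mate (Suc m) u + 8 * (real (length xs) - 1) + s"
  proof -
    have "(\<Sum>i<d. f i) =
        15 * (\<Sum>i<d. case mate (nb u ! i) of None \<Rightarrow> 0 | Some w \<Rightarrow> hit mate m w) +
        real d * (8 * real (length xs) + s)"
      unfolding f_def sum.distrib sum_distrib_left by (simp add: distrib_left)
    then show ?thesis using d_pos by (simp add: add_divide_distrib algebra_simps)
  qed
  have "tcost (m + 7) (conf 8 R M) \<le> ennreal (7 + (\<Sum>i<d. f i) / real d)"
  proof (rule walk_block[OF Suc.prems(1) Suc.prems(3)[folded u_def] u(2) _ f_nonneg order.refl])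
    fix i R' assume i: "i < d" and R': "regs k R'" "R' 5 = R 5" "R' 6 = M (nb u ! i + n)"
    define v where "v = nb u ! i"
    define M' where "M' = M(2 * n + u := v + n)"
    have v: "v \<in> set (nb u)" unfolding v_def using i length_nb[OF u(2)] by (intro nth_mem) simp
    have vn: "v < n" by (rule nb_less[OF u(2) v])
    have R'6: "R' 6 = (case mate v of None \<Rightarrow> 0 | Some w \<Rightarrow> 2 * n + w)"
      using R'(3) Suc.prems(5) vn by (simp add: rep_def v_def)
    \<comment> \<open>Matched vertices have numbers below \<open>n\<close>, so the overwritten
      choice cell is none of their output cells.\<close>
    have "mate v' \<noteq> Some (2 * n + u)" for v'
      using validD(2)[OF Suc.prems(4), of v' "2 * n + u"] by auto
    then have rep': "rep mate M'"
      using Suc.prems(5) vn u(2) by (auto simp: rep_def M'_def)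
    \<comment> \<open>The cell of \<open>u\<close> becomes nonzero, which is right because
      \<open>u\<close> is matched or is the start vertex.\<close>
    have marked': "0 < M' (2 * n + z) \<longleftrightarrow> z \<in> ran mate" if "z < n" "z \<noteq> x0" for z
      using Suc.prems(6)[OF that] Suc.prems(10) u(1) that vn by (auto simp: M'_def)
    have "tcost m (conf (if 0 < R' 6 then 8 else 15) R' M') \<le> ennreal (f i)"
    proof (cases "mate v")
      case None
      have "last xs \<notin> set (butlast xs)"
        using Suc.prems(7,9) by (metis append_butlast_last_id distinct_append disjoint_iff list.set_intros(1))
      then have path': "path mate M' xs"
        by (intro successively_mono_butlast[OF Suc.prems(11)]) (auto simp: link_def M'_def u_def)
      have last': "link mate M' (last xs) None"
        using v None by (auto simp: link_def M'_def u_def)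
      \<comment> \<open>As first vertex of the path, \<open>x0\<close> has a remembered choice,
        hence a nonzero cell.\<close>
      have "\<exists>w. link mate M' x0 w"
        using path' last' Suc.prems(7,8) by (cases xs) (auto simp: successively_Cons split: if_splits)
      then have "0 < M' (2 * n + x0)" using Suc.prems(12) by (auto simp: link_def)
      then have mk: "marked (insert x0 (ran mate)) M'" using marked' by (auto simp: marked_def)
      have "tcost m (conf 15 R' M') \<le> ennreal (8 * real (length xs) + s)"
      proof (rule augment[OF R'(1) _ Suc.prems(4) rep' mk Suc.prems(7,9) xs_less path' last' _ _ s])
        show "R' 5 = 2 * n + hd xs" using R'(2) Suc.prems(2) by simp
      qed (use Suc.prems(8,13) in simp_all)
      then show ?thesis using None R'6 by (simp add: f_def v_def[symmetric])
    next
      case (Some w)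
      obtain ys where ys: "path mate M' ys" "ys \<noteq> []" "distinct ys"
        "hd ys = hd xs" "last ys = w" "set ys \<subseteq> insert w (set xs)" "length ys \<le> Suc (length xs)"
        using path_step[OF Suc.prems(11,7,9) v[unfolded u_def] Some] unfolding M'_def u_def by blast
      have ys_sub: "set ys \<subseteq> insert x0 (ran mate)"
        using ys(6) Suc.prems(10) ranI[of mate v, OF Some] by auto
      have "tcost m (conf 8 R' M') \<le>
          ennreal (15 * hit mate m (last ys) + 8 * (real (length ys) - 1) + s)"
      proof (rule Suc.IH[OF R'(1) _ _ Suc.prems(4) rep' marked' ys(2) _ ys(3) ys_sub ys(1) Suc.prems(12,13)])
        show "R' 5 = 2 * n + hd ys" using R'(2) Suc.prems(2) ys(4) by simp
        show "R' 6 = 2 * n + last ys" using R'6 Some ys(5) by simp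
        show "hd ys = x0" using ys(4) Suc.prems(8) by simp
      qed
      also have "\<dots> \<le> ennreal (f i)"
        using ys(5,7) Some by (intro ennreal_leI) (simp add: f_def v_def[symmetric])
      finally show ?thesis using Some R'6 u(2) by simp
    qed
    then show "tcost m (conf (if 0 < R' 6 then 8 else 15) R' (M(2 * n + u := nb u ! i + n))) \<le> ennreal (f i)"
      by (simp add: M'_def v_def)
  qed
  then show ?case
    using cost_mono[of "Suc m" "m + 7" match_prog I correct "conf 8 R M"] unfolding sum_f u_def by simp
qed simp

text \<open>A rejected draw returns to the same situation, so the bound \<open>r\<close> solves
  \<open>n * r = 4 * n + k * r + 15 * n + (n - k) * (1 + s)\<close>: 4 instructions per draw, 15
  units per walk step with \<open>hit\<close> summing to at most \<open>n\<close> over the unmatched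
  vertices, and 1 for entering the walk.\<close>

lemma start:
  assumes "regs k R" "valid mate" "rep mate M" "marked (ran mate) M" "card (ran mate) = k" "k < n"
    and s: "0 \<le> s" "\<And>m mate' R' M'. regs k R' \<Longrightarrow> valid mate' \<Longrightarrow> rep mate' M' \<Longrightarrow>
       marked (ran mate') M' \<Longrightarrow> card (ran mate') = Suc k \<Longrightarrow> tcost m (conf 23 R' M') \<le> ennreal s"
  shows "tcost m (conf 3 R M) \<le> ennreal (19 * real n / real (n - k) + (1 + s))"
  using assms(1)
proof (induction m arbitrary: R)
  case (Suc m)
  define r where "r = 19 * real n / real (n - k) + (1 + s)"
  have r: "0 \<le> r" using s(1) by (simp add: r_def)
  have ran: "ran mate \<subseteq> {..<n}" "finite (ran mate)"
    using ran_valid[OF assms(2)] finite_subset by auto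
  define f where "f u = (if u \<in> ran mate then r else 15 * hit mate m u + (1 + s))" for u
  have f_nonneg: "0 \<le> f u" for u using r s(1) by (simp add: f_def hit_nonneg)
  have "(\<Sum>u<n. f u) = real k * r + (15 * (\<Sum>u\<in>{..<n} - ran mate. hit mate m u) + real (n - k) * (1 + s))"
    using assms(5) ran
    by (simp add: f_def sum.If_cases Int_absorb1 sum.distrib sum_distrib_left card_Diff_subset
        flip: Diff_eq)
  also have "\<dots> \<le> real k * r + (15 * real n + real (n - k) * (1 + s))"
    using sum_hit_unmatched_le[OF assms(2), of m] by simp
  also have "real (n - k) * (1 + s) = real (n - k) * r - 19 * real n"
    using assms(6) by (simp add: r_def field_simps)
  also have "real k * r + (15 * real n + (real (n - k) * r - 19 * real n)) = real n * r - 4 * real n"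
    using assms(6) by (simp add: of_nat_diff algebra_simps)
  finally have sum_f: "4 + (\<Sum>u<n. f u) / real n \<le> r"
    using assms(6) by (simp add: field_simps)
  have "tcost (m + 4) (conf 3 R M) \<le> ennreal r"
  proof (rule start_block[OF Suc.prems _ _ f_nonneg sum_f])
    fix u R' assume u: "u < n" and R': "regs k R'" "R' 5 = 2 * n + u"
    have marked: "0 < M (u + 2 * n) \<longleftrightarrow> u \<in> ran mate"
      using assms(4) u by (simp add: marked_def add.commute)
    show "tcost m (conf (if 0 < M (u + 2 * n) then 3 else 7) R' M) \<le> ennreal (f u)"
    proof (cases "u \<in> ran mate")
      case True
      then show ?thesis using Suc.IH[OF R'(1)] marked by (simp add: f_def r_def)
    next
      case False
      \<comment> \<open>The initial path is \<open>[u]\<close>, for which no savings are required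
        yet.\<close>
      have "tcost m (conf 8 (R'(6 := R' 5)) M) \<le>
          ennreal (15 * hit mate m (last [u]) + 8 * (real (length [u]) - 1) + s)"
      proof (rule walk)
        show "0 < M (2 * n + z) \<longleftrightarrow> z \<in> ran mate" if "z < n" for z
          using assms(4) that by (simp add: marked_def)
        show "tcost m' (conf 23 R'' M'') \<le> ennreal s"
          if "regs k R''" "valid mate'" "rep mate' M''" "marked (insert u (ran mate)) M''"
            "ran mate' = insert u (ran mate)" for m' mate' R'' M''
          using that False ran(2) assms(5) by (intro s(2)) auto
      qed (use R' assms False u s(1) in \<open>auto simp: regs_def\<close>)
      then have "tcost m (conf 7 R' M) \<le> ennreal (f u)"
        by (rule tcost_det[rotated 2])
          (use False s(1) in \<open>auto simp: exec_simps f_def hit_nonneg\<close>)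
      then show ?thesis using False marked by simp
    qed
  qed (use assms(6) in auto)
  then show ?case
    using cost_mono[of "Suc m" "m + 4" match_prog I correct "conf 3 R M"] unfolding r_def by simp
qed simp

text \<open>Induction downwards from \<open>n\<close>. The 3 pays for the loop test, the entry into
  the walk and the increment; the leading 1 is the final test that leaves the loop.\<close>

lemma outer:
  assumes "regs k R" "valid mate" "rep mate M" "marked (ran mate) M" "card (ran mate) = k"
  shows "tcost m (conf 24 R M) \<le> ennreal (1 + (\<Sum>i=k..<n. 3 + 19 * real n / real (n - i)))"
proof -
  have "k \<le> n" using card_mono[OF _ ran_valid[OF assms(2)]] assms(5) by simp
  then show ?thesis using assms
  proof (induction k arbitrary: m R mate M rule: inc_induct)
    case base
    have "ran mate = {..<n}"
      using base(5) ran_valid[OF base(2)] by (intro card_subset_eq) auto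
    then have "correct (conf 25 R M)"
      using base(2,3) by (auto simp: correct_def rep_def)
    then have "tcost m (conf 25 R M) \<le> ennreal 0"
      by (cases m) (auto simp: exec_simps)
    then show ?case
      by (rule tcost_det[rotated 2]) (use base(1) in \<open>auto simp: exec_simps regs_def\<close>)
  next
    case (step k)
    define s where "s = 1 + (\<Sum>i=Suc k..<n. 3 + 19 * real n / real (n - i))"
    have s: "0 \<le> s" by (auto simp: s_def intro!: add_nonneg_nonneg sum_nonneg)
    have inc: "tcost m' (conf 23 R' M') \<le> ennreal (1 + s)"
      if "regs k R'" "valid mate'" "rep mate' M'" "marked (ran mate') M'" "card (ran mate') = Suc k"
      for m' mate' R' M'
    proof -
      have "regs (Suc k) (R'(2 := Suc k))" using that(1) by (simp add: regs_def)
      then have "tcost m' (conf 24 (R'(2 := Suc k)) M') \<le> ennreal s"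
        unfolding s_def using that(2-5) by (rule step.IH)
      then show ?thesis
        by (rule tcost_det[rotated 2]) (use that(1) s in \<open>auto simp: exec_simps regs_def\<close>)
    qed
    have "tcost m (conf 3 R M) \<le> ennreal (19 * real n / real (n - k) + (1 + (1 + s)))"
      using step.prems step.hyps s by (intro start inc) auto
    then show ?case
      by (rule tcost_det[rotated 2])
        (use step.prems(1) step.hyps s in \<open>auto simp: exec_simps regs_def s_def sum.atLeast_Suc_lessThan\<close>)
  qed
qed

text \<open>All-zero memory represents the empty matching. Three setup instructions and the final
  loop test make up the 4.\<close>

lemma tcost_init:
  "tcost m (init_config I) \<le> ennreal (4 + (\<Sum>i<n. 3 + 19 * real n / real (n - i)))"
proof -
  define R where "R = ((\<lambda>_. 0)(0 := n, 1 := d, 4 := 1, 3 := n + n) :: nat \<Rightarrow> nat)"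
  define t where "t = 1 + (\<Sum>i<n. 3 + 19 * real n / real (n - i))"
  have t: "0 \<le> t" by (auto simp: t_def intro!: add_nonneg_nonneg sum_nonneg)
  have "tcost m (conf 24 R (\<lambda>_. 0)) \<le> ennreal t"
    unfolding t_def lessThan_atLeast0
    by (rule outer[where mate = "\<lambda>_. None"]) (auto simp: regs_def R_def valid_def rep_def marked_def)
  then have "tcost m (conf 2 R (\<lambda>_. 0)) \<le> ennreal (1 + t)"
    by (rule tcost_det[rotated 2]) (use t in \<open>auto simp: exec_simps\<close>)
  then have "tcost m (conf 1 ((\<lambda>_. 0)(0 := n, 1 := d, 4 := 1)) (\<lambda>_. 0)) \<le> ennreal (2 + t)"
    by (rule tcost_det[rotated 2]) (use t in \<open>auto simp: exec_simps fetch(2)[unfolded One_nat_def] R_def\<close>)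
  then have "tcost m (init_config I) \<le> ennreal (3 + t)"
    by (rule tcost_det[rotated 2]) (use t in \<open>auto simp: exec_simps init_config_def num_I deg_I\<close>)
  then show ?thesis by (simp add: t_def algebra_simps)
qed

end

section \<open>Asymptotics of the bound and transfer to the graph\<close>

lemma harm_le_ln: "n \<ge> 1 \<Longrightarrow> harm n \<le> 1 + ln (real n)"
proof -
  assume "n \<ge> 1"
  then obtain m where m: "n = Suc m" by (cases n) auto
  have "harm (Suc m) - ln (real (Suc m)) \<le> harm (Suc 0) - ln (real (Suc 0))"
    using decseqD[OF decseq_harm_diff_ln, of 0 m] by simp
  then show ?thesis by (simp add: m harm_Suc harm_expand(1))
qed

lemma sum_inverse_eq_harm: "(\<Sum>i<n. 1 / real (n - i)) = harm n"
  unfolding harm_def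
  by (rule sum.reindex_bij_witness[of _ "\<lambda>k. n - k" "\<lambda>i. n - i"]) (auto simp: inverse_eq_divide)

lemma time_bound_bigo: "(\<lambda>n. 4 + (\<Sum>i<n. 3 + 19 * real n / real (n - i))) \<in> O(\<lambda>n. real n * ln (real n))"
proof -
  have "(\<Sum>i<n. 3 + 19 * real n / real (n - i)) = 3 * real n + 19 * real n * harm n" for n
    unfolding sum_inverse_eq_harm[symmetric] by (simp add: sum.distrib sum_distrib_left)
  moreover have "real n * harm n \<le> real n * (1 + ln (real n))" if "n \<ge> 1" for n
    using that by (intro mult_left_mono harm_le_ln) auto
  ultimately have "norm (4 + (\<Sum>i<n. 3 + 19 * real n / real (n - i))) \<le>
      1 * norm (4 + 3 * real n + 19 * (real n * (1 + ln (real n))))" if "n \<ge> 1" for n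
    using that by (simp add: harm_nonneg mult.assoc)
  then have "eventually (\<lambda>n. norm (4 + (\<Sum>i<n. 3 + 19 * real n / real (n - i))) \<le>
      1 * norm (4 + 3 * real n + 19 * (real n * (1 + ln (real n))))) sequentially"
    by (rule eventually_sequentiallyI)
  then have "(\<lambda>n. 4 + (\<Sum>i<n. 3 + 19 * real n / real (n - i))) \<in>
      O(\<lambda>n. 4 + 3 * real n + 19 * (real n * (1 + ln (real n))))"
    by (rule bigoI)
  also have "(\<lambda>n. 4 + 3 * real n + 19 * (real n * (1 + ln (real n)))) \<in> O(\<lambda>n. real n * ln (real n))"
    by real_asymp
  finally show ?thesis .
qed

text \<open>Injectivity leaves one edge per vertex in its own coordinate; disjointness of
  \<open>P\<close> and \<open>Q\<close> rules out incidence through the other one.\<close>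

lemma perfect_matching_permutation:
  assumes "bipartite_graph P Q E" "bij_betw p {..<n} P" "bij_betw q {..<n} Q"
    and f: "bij_betw f {..<n} {..<n}" "\<And>i. i < n \<Longrightarrow> (p i, q (f i)) \<in> E"
  shows "perfect_matching P Q E ((\<lambda>i. (p i, q (f i))) ` {..<n})"
proof -
  let ?M = "(\<lambda>i. (p i, q (f i))) ` {..<n}"
  have f_less: "f i < n" if "i < n" for i using f(1) that by (auto simp: bij_betw_def)
  have disj: "p i \<noteq> q j" "q j \<noteq> p i" if "i < n" "j < n" for i j
    using assms(1-3) that by (auto simp: bipartite_graph_def bij_betw_def)
  have p_inj: "p i = p j \<longleftrightarrow> i = j" if "i < n" "j < n" for i j
    using assms(2) that by (auto simp: bij_betw_def inj_on_def)
  have q_inj: "q (f i) = q (f j) \<longleftrightarrow> i = j" if "i < n" "j < n" for i j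
    using assms(3) f(1) that f_less by (auto simp: bij_betw_def inj_on_def)
  have "incident ?M (p i) = {(p i, q (f i))}" if "i < n" for i
    using that disj p_inj f_less by (auto simp: incident_def)
  moreover have "incident ?M (q (f i)) = {(p i, q (f i))}" if "i < n" for i
    using that disj q_inj f_less by (fastforce simp: incident_def)
  moreover have "P = p ` {..<n}" "Q = (\<lambda>i. q (f i)) ` {..<n}"
    using assms(2,3) f(1) by (auto simp: bij_betw_def image_image[symmetric, of q f])
  ultimately show ?thesis
    using f(2) by (auto simp: perfect_matching_def)
qed

theorem theorem1:
  shows "\<exists>(prog :: program) (T :: nat \<Rightarrow> real).
    T \<in> O(\<lambda>n. real n * ln (real n)) \<and>
    (\<forall>(P :: nat set) (Q :: nat set) (E :: (nat \<times> nat) set) (d :: nat) (n :: nat)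
        (p :: nat \<Rightarrow> nat) (q :: nat \<Rightarrow> nat) (I :: adj_input).
       bipartite_graph P Q E \<longrightarrow> d \<ge> 1 \<longrightarrow> regular P Q E d \<longrightarrow> card P = n \<longrightarrow> card Q = n \<longrightarrow>
       adjacency_arrays P Q E d p q I \<longrightarrow>
         (\<forall>(c, t) \<in> set_spmf (run prog I). outputs_perfect_matching P Q E p q n c) \<and>
         expected_time prog I \<le> ennreal (T n))"
proof (intro exI conjI allI impI)
  show "(\<lambda>n. 4 + (\<Sum>i<n. 3 + 19 * real n / real (n - i))) \<in> O(\<lambda>n. real n * ln (real n))"
    by (rule time_bound_bigo)
next
  fix P Q :: "nat set" and E :: "(nat \<times> nat) set" and d n :: nat
    and p q :: "nat \<Rightarrow> nat" and I :: adj_input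
  assume G: "bipartite_graph P Q E" and d: "d \<ge> 1" and n: "card P = n"
    and adj: "adjacency_arrays P Q E d p q I"
  have num: "num I = n" "deg I = d" "length (nbrs_P I) = n"
    and bij: "bij_betw p {..<n} P" "bij_betw q {..<n} Q"
    using adj n by (auto simp: adjacency_arrays_def)
  have nb: "length (nbrs_P I ! i) = d" "distinct (nbrs_P I ! i)"
      "set (nbrs_P I ! i) = {j. j < n \<and> (p i, q j) \<in> E}" if "i < n" for i
    using adj that num(1) unfolding adjacency_arrays_def by auto
  have nbQ: "length (nbrs_Q I ! j) = d" "distinct (nbrs_Q I ! j)"
      "set (nbrs_Q I ! j) = {i. i < n \<and> (p i, q j) \<in> E}" if "j < n" for j
    using adj that num(1) unfolding adjacency_arrays_def by auto
  interpret matching_machine n d I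
  proof
    \<comment> \<open>The array of \<open>v\<close> on the side of \<open>Q\<close> lists exactly
      the counted vertices, without repetition.\<close>
    show "card {u. u < n \<and> v \<in> set (nbrs_P I ! u)} = d" if "v < n" for v
    proof -
      have "{u. u < n \<and> v \<in> set (nbrs_P I ! u)} = set (nbrs_Q I ! v)"
        using that by (auto simp: nb nbQ)
      then show ?thesis using distinct_card[OF nbQ(2)[OF that]] nbQ(1)[OF that] by simp
    qed
  qed (use d num nb in auto)
  show "expected_time match_prog I \<le> ennreal (4 + (\<Sum>i<n. 3 + 19 * real n / real (n - i)))"
    by (rule run_time_le(1)[OF tcost_init])
  show "\<forall>(c, t) \<in> set_spmf (run match_prog I). outputs_perfect_matching P Q E p q n c"
  proof safe
    fix c t assume "(c, t) \<in> set_spmf (run match_prog I)"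
    then have "correct c" by (rule run_time_le(2)[OF tcost_init])
    then obtain mate where mate: "valid mate" "ran mate = {..<n}"
        "\<And>v u. mate v = Some u \<Longrightarrow> mem c u = v"
      by (auto simp: correct_def)
    \<comment> \<open>\<open>mate\<close> inverts the output, which makes \<open>mem c\<close>
      injective and hence a permutation of the finite index set.\<close>
    have mem: "mate (mem c u) = Some u" if "u < n" for u
    proof -
      have "u \<in> ran mate" using mate(2) that by simp
      then show ?thesis using mate(3) by (auto simp: ran_def)
    qed
    have less: "mem c u < n" and edge: "(p u, q (mem c u)) \<in> E" if "u < n" for u
      using validD[OF mate(1) mem[OF that]] that by (auto simp: nb)
    have "inj_on (mem c) {..<n}"
      by (rule inj_onI) (metis mem lessThan_iff option.inject)
    then have "bij_betw (mem c) {..<n} {..<n}"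
      using endo_inj_surj[of "{..<n}" "mem c"] less by (auto simp: bij_betw_def)
    then show "outputs_perfect_matching P Q E p q n c"
      using perfect_matching_permutation[OF G bij] less edge
      by (simp add: outputs_perfect_matching_def)
  qed
qed

end
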